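(* If $G$ is a connected graph that is claw-$o_{-1}$-heavy and $Z_1$-free, then $G$ is traceable.
   Context: All graphs are finite and simple; $d(v)$ is the degree of $v$ in $G$. A claw is $K_{1,3}$. $G$ (on $n$ vertices) is claw-$o_{-1}$-heavy if every induced subgraph of $G$ isomorphic to $K_{1,3}$ contains two nonadjacent vertices whose degree sum in $G$ is at least $n-1$. $Z_1$ is the graph obtained from a triangle by attaching one pendant vertex to one of its vertices; $G$ is $Z_1$-free if it has no induced subgraph isomorphic to $Z_1$. Traceable means having a path through all vertices. *)

theory Defs
  imports "Graph_Theory.Graph_Theory"
begin

text \<open>
  A finite simple graph is a symmetric digraph satisfying the locale \<open>graph\<close>: every edge is a
  pair of opposite arcs, so the degree of a vertex is its out-degree.
\<close>

abbreviation degree :: "('a, 'b) pre_digraph \<Rightarrow> 'a \<Rightarrow> nat" where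
  "degree G v \<equiv> out_degree G v"

text \<open>
  The degrees are taken in \<^term>\<open>G\<close>, not in the claw \<^term>\<open>H\<close>. The truncated subtraction is
  harmless, since a graph containing a claw has at least four vertices.
\<close>

definition claw_o_minus1_heavy :: "('a, 'b) pre_digraph \<Rightarrow> bool" where
  "claw_o_minus1_heavy G \<longleftrightarrow>
    (\<forall>H. induced_subgraph H G \<and> K\<^bsub>1,3\<^esub> H \<longrightarrow>
      (\<exists>u \<in> verts H. \<exists>v \<in> verts H. u \<noteq> v \<and> \<not> u \<rightarrow>\<^bsub>G\<^esub> v \<and>
        degree G u + degree G v \<ge> card (verts G) - 1))"

text \<open>The triangle \<open>0, 1, 2\<close> with the pendant vertex \<open>3\<close> attached to \<open>0\<close>.\<close>

definition Z1 :: "nat pair_pre_digraph" where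
  "Z1 = \<lparr> pverts = {0, 1, 2, 3},
    parcs = {(0,1), (1,0), (0,2), (2,0), (1,2), (2,1), (0,3), (3,0)} \<rparr>"

lemma pair_graph_Z1: "pair_graph Z1"
  by unfold_locales (auto simp: Z1_def symmetric_def sym_def)

definition Z1_free :: "('a, 'b) pre_digraph \<Rightarrow> bool" where
  "Z1_free G \<longleftrightarrow> \<not> (\<exists>H. induced_subgraph H G \<and> digraph_iso H (with_proj Z1))"

definition traceable :: "('a, 'b) pre_digraph \<Rightarrow> bool" where
  "traceable G \<longleftrightarrow> (\<exists>p. vpath p G \<and> set p = verts G)"

end

theory Submission
  imports Defs
begin

text \<open>
  If \<open>G\<close> contains a triangle, then every edge of \<open>G\<close> dominates \<open>G\<close>, since \<open>G\<close> is connected and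
  \<open>Z\<^sub>1\<close>-free. Nonadjacent vertices are then twins, and the claw condition yields minimum
  degree at least \<open>(n - 1) / 2\<close>. A longest path missing a vertex \<open>u\<close> would contain all neighbours
  of \<open>u\<close>, no two of them consecutive and none of them at an end, which is too few.

  If \<open>G\<close> is triangle-free, any three neighbours of a vertex span a claw with it. Let \<open>x\<close> have maximum
  degree; if this degree is at least three, some neighbour \<open>w\<close> of \<open>x\<close> has degree at least
  \<open>(n - 1) / 2\<close>. The neighbourhoods \<open>A\<close> of \<open>x\<close> and \<open>B\<close> of \<open>w\<close> are disjoint independent sets covering
  all vertices but at most one, so \<open>G\<close> is almost a balanced complete bipartite graph, and the claw
  condition at \<open>x\<close> and \<open>w\<close> leaves so few missing edges that a Hamiltonian path can be written down.
\<close>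

section \<open>Paths in finite simple graphs\<close>

locale fin_simple_graph =
  fixes V :: "'a set" and adj :: "'a \<Rightarrow> 'a \<Rightarrow> bool"
  assumes finite_V: "finite V"
    and adj_sym: "adj u v \<Longrightarrow> adj v u"
    and adj_irrefl: "\<not> adj v v"
    and adj_V: "adj u v \<Longrightarrow> u \<in> V"
begin

definition nbh :: "'a \<Rightarrow> 'a set" where
  "nbh v = {u. adj v u}"

abbreviation deg :: "'a \<Rightarrow> nat" where
  "deg v \<equiv> card (nbh v)"

definition path :: "'a list \<Rightarrow> bool" where
  "path p \<longleftrightarrow> distinct p \<and> set p \<subseteq> V \<and> successively adj p"

definition has_ham_path :: bool where
  "has_ham_path \<longleftrightarrow> (\<exists>p. path p \<and> set p = V)"

lemma adj_commute: "adj u v \<longleftrightarrow> adj v u"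
  using adj_sym by blast

lemma successively_adj_rev [simp]: "successively adj (rev p) \<longleftrightarrow> successively adj p"
proof -
  have "(\<lambda>u v. adj v u) = adj"
    by (intro ext iffI) (erule adj_sym)+
  then show ?thesis
    unfolding successively_rev by (rule arg_cong)
qed

lemma in_nbh [simp]: "u \<in> nbh v \<longleftrightarrow> adj v u"
  by (simp add: nbh_def)

lemma nbh_subset: "nbh v \<subseteq> V"
  using adj_V adj_sym by (auto simp: nbh_def)

lemma finite_nbh [simp]: "finite (nbh v)"
  using nbh_subset finite_V finite_subset by blast

lemma has_ham_pathI:
  assumes "distinct p" "set p = V" "successively adj p"
  shows has_ham_path
  using assms by (auto simp: has_ham_path_def path_def)

lemma path_rev: "path p \<Longrightarrow> path (rev p)"
  by (auto simp: path_def simp del: successively_rev)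

lemma path_Cons:
  "p \<noteq> [] \<Longrightarrow> path (u # p) \<longleftrightarrow> u \<notin> set p \<and> path p \<and> adj u (hd p)"
  using adj_V by (cases p) (auto simp: path_def)

lemma length_path_le:
  assumes "path p"
  shows "length p \<le> card V"
  using assms card_mono[OF finite_V, of "set p"] distinct_card[of p] by (simp add: path_def)

lemma longest_path:
  obtains p where "path p" "\<And>q. path q \<Longrightarrow> length q \<le> length p"
proof -
  have "path []"
    by (simp add: path_def)
  moreover have "\<forall>q. path q \<longrightarrow> length q < Suc (card V)"
    using length_path_le le_imp_less_Suc by blast
  ultimately have "\<exists>p. path p \<and> (\<forall>q. path q \<longrightarrow> length q \<le> length p)"
    by (rule Lattices_Big.ex_has_greatest_nat)
  then show ?thesis
    using that by auto
qed

text \<open>For longest paths: a vertex off such a path cannot be adjacent to two consecutive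
  vertices of it.\<close>

lemma path_insert:
  assumes "path p" "Suc i < length p" "u \<notin> set p" "adj u (p ! i)" "adj u (p ! Suc i)"
  shows "path (take (Suc i) p @ u # drop (Suc i) p)"
proof -
  have ne: "take (Suc i) p \<noteq> []" "drop (Suc i) p \<noteq> []"
    using assms(2) by auto
  have l: "last (take (Suc i) p) = p ! i" "hd (drop (Suc i) p) = p ! Suc i"
    using assms(2) by (simp_all add: take_Suc_conv_app_nth hd_drop_conv_nth)
  have "successively adj (take (Suc i) p @ drop (Suc i) p)" "distinct (take (Suc i) p @ drop (Suc i) p)"
    using assms(1) by (simp_all add: path_def)
  then have s: "successively adj (take (Suc i) p)" "successively adj (drop (Suc i) p)"
    and d: "distinct (take (Suc i) p)" "distinct (drop (Suc i) p)"
      "set (take (Suc i) p) \<inter> set (drop (Suc i) p) = {}"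
    unfolding successively_append_iff distinct_append by auto
  have "set (take (Suc i) p) \<subseteq> set p" "set (drop (Suc i) p) \<subseteq> set p"
    by (rule set_take_subset set_drop_subset)+
  then show ?thesis
    using s d assms ne l adj_V adj_commute
    by (auto simp: path_def successively_append_iff successively_Cons)
qed

section \<open>Hamiltonian paths in nearly complete bipartite graphs\<close>

text \<open>Both ends are prescribed so that the path can be spliced to further vertices.
  Inductively, a path from \<open>a'\<close> to \<open>b'\<close> through the other vertices is run
  backwards between \<open>a\<close> and \<open>b\<close>.\<close>

lemma alternating_path:
  assumes "finite A" "card A = Suc k" "card B = Suc k" "A \<inter> B = {}"
    and "\<And>a b. a \<in> A \<Longrightarrow> b \<in> B \<Longrightarrow> adj a b"
    and "a \<in> A" "b \<in> B"
  shows "\<exists>p. p \<noteq> [] \<and> distinct p \<and> set p = A \<union> B \<and> successively adj p \<and> hd p = a \<and> last p = b"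
  using assms
proof (induction k arbitrary: A B a b)
  case 0
  then have "A = {a}" "B = {b}"
    by (auto simp: card_1_singleton_iff)
  with 0 show ?case
    by (intro exI[of _ "[a, b]"]) auto
next
  case (Suc k)
  have fB: "finite B"
    using Suc.prems(3) card.infinite by fastforce
  have "card (A - {a}) = Suc k" "card (B - {b}) = Suc k"
    using Suc.prems fB by simp_all
  moreover from this obtain a' b' where ab': "a' \<in> A - {a}" "b' \<in> B - {b}"
    by (metis card.empty ex_in_conv nat.distinct(1))
  moreover have "(A - {a}) \<inter> (B - {b}) = {}"
    using Suc.prems by auto
  ultimately obtain p where p: "p \<noteq> []" "distinct p" "set p = (A - {a}) \<union> (B - {b})"
    "successively adj p" "hd p = a'" "last p = b'"
    using Suc.IH[of "A - {a}" "B - {b}" a' b'] Suc.prems by auto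
  text \<open>The path \<open>p\<close> starts in \<open>A\<close>, so it must be reversed before \<open>a\<close> can be prepended.\<close>
  have "adj a b'" "adj a' b"
    using Suc.prems ab' by auto
  moreover have "successively adj (rev p)"
    using p(4) by (simp del: successively_rev)
  moreover have "hd (rev p) = b'" "last (rev p) = a'"
    using p by (auto simp: hd_rev last_rev)
  ultimately have "successively adj (a # rev p @ [b])"
    using p(1) by (auto simp: successively_append_iff successively_Cons hd_append)
  moreover have "distinct (a # rev p @ [b])" "set (a # rev p @ [b]) = A \<union> B"
    using p Suc.prems by auto
  ultimately show ?case
    by (intro exI[of _ "a # rev p @ [b]"]) auto
qed

lemma alternating_path_same_side:
  assumes "finite A" "card A = Suc (card B)" "B \<noteq> {}" "finite B" "A \<inter> B = {}"
    and "\<And>a b. a \<in> A \<Longrightarrow> b \<in> B \<Longrightarrow> adj a b"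
    and "a \<in> A" "a' \<in> A" "a \<noteq> a'"
  shows "\<exists>p. p \<noteq> [] \<and> distinct p \<and> set p = A \<union> B \<and> successively adj p \<and> hd p = a \<and> last p = a'"
proof -
  obtain k where k: "card B = Suc k"
    using assms by (metis card_gt_0_iff gr0_conv_Suc)
  obtain b where b: "b \<in> B"
    using assms by auto
  have "card (A - {a'}) = Suc k"
    using assms k by simp
  then obtain p where p: "p \<noteq> []" "distinct p" "set p = (A - {a'}) \<union> B"
    "successively adj p" "hd p = a" "last p = b"
    using alternating_path[of "A - {a'}" k B a b] assms k b by auto
  have "adj b a'"
    using assms b adj_sym by blast
  then show ?thesis
    using p assms by (intro exI[of _ "p @ [a']"]) (auto simp: successively_append_iff)
qed

text \<open>The only possibly deficient vertex \<open>a\<close> starts the path; the rest is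
  balanced and complete, and has an alternating path starting in \<open>b\<close>.\<close>

lemma ham_path_bipartite_Suc:
  assumes V: "V = A \<union> B" "A \<inter> B = {}" "card A = Suc (card B)"
    and a: "a \<in> A" "b \<in> B" "adj a b"
    and compl: "\<And>a' b'. a' \<in> A \<Longrightarrow> a' \<noteq> a \<Longrightarrow> b' \<in> B \<Longrightarrow> adj a' b'"
  shows has_ham_path
proof -
  have fin: "finite A" "finite B"
    using finite_V V by auto
  obtain k where k: "card B = Suc k"
    using a fin by (metis card_gt_0_iff empty_iff gr0_conv_Suc)
  have card: "card (A - {a}) = Suc k"
    using a fin V k by simp
  then obtain a' where "a' \<in> A - {a}"
    by (metis card.empty ex_in_conv nat.distinct(1))
  then obtain p where "p \<noteq> []" "distinct p" "set p = B \<union> (A - {a})" "successively adj p" "hd p = b"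
    using alternating_path[of B k "A - {a}" b a'] fin k card V a compl adj_sym by blast
  then show ?thesis
    using V a by (intro has_ham_pathI[of "a # p"]) (auto simp: successively_Cons)
qed

text \<open>The two possibly deficient vertices are used up in the initial segment
  \<open>[a, b, a', b']\<close>; \<open>3 \<le> card A\<close> keeps the complete rest
  nonempty.\<close>

lemma ham_path_balanced_bipartite:
  assumes V: "V = A \<union> B" "A \<inter> B = {}" "card A = card B" "3 \<le> card A"
    and in_A: "a \<in> A" "a' \<in> A" "a \<noteq> a'" and in_B: "b \<in> B" "b' \<in> B" "b \<noteq> b'"
    and adj: "adj a b" "adj a' b" "adj a' b'"
    and compl: "\<And>c d. c \<in> A \<Longrightarrow> c \<noteq> a \<Longrightarrow> c \<noteq> a' \<Longrightarrow> d \<in> B \<Longrightarrow> adj c d"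
  shows has_ham_path
proof -
  have fin: "finite A" "finite B"
    using finite_V V by auto
  obtain k where "card A = 3 + k"
    using le_Suc_ex[OF V(4)] by auto
  then have k: "card A = Suc (Suc (Suc k))"
    by simp
  then have "card B = Suc (Suc (Suc k))"
    using V(3) by simp
  then have cards: "card (A - {a, a'}) = Suc k" "card (B - {b, b'}) = Suc k"
    using in_A in_B fin k by (simp_all add: card_Diff_subset)
  then obtain c d where cd: "c \<in> A - {a, a'}" "d \<in> B - {b, b'}"
    by (metis card.empty ex_in_conv nat.distinct(1))
  have "finite (A - {a, a'})" "(A - {a, a'}) \<inter> (B - {b, b'}) = {}"
    and "\<And>c d. c \<in> A - {a, a'} \<Longrightarrow> d \<in> B - {b, b'} \<Longrightarrow> adj c d"
    using fin(1) V(2) compl by auto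
  from alternating_path[OF this(1) cards this(2,3) cd]
  obtain p where "p \<noteq> []" "distinct p" "set p = (A - {a, a'}) \<union> (B - {b, b'})"
    "successively adj p" "hd p = c"
    by auto
  moreover have "adj b a'" "adj b' c"
    using adj compl[of c b'] cd in_B adj_sym by auto
  ultimately show ?thesis
    using V in_A in_B adj
    by (intro has_ham_pathI[of "[a, b, a', b'] @ p"]) (auto simp: successively_Cons)
qed

text \<open>Without \<open>b\<close> and \<open>z\<close> the sides differ by one, so an alternating
  path from \<open>a\<close> to \<open>a'\<close> covers the rest; \<open>b\<close> and
  \<open>z\<close> are attached to its ends.\<close>

lemma ham_path_bipartite_extra_end:
  assumes V: "V = insert z (A \<union> B)" "z \<notin> A \<union> B" "A \<inter> B = {}" "card A = card B" "3 \<le> card A"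
    and b: "b \<in> B" and in_A: "a \<in> A" "a' \<in> A" "a \<noteq> a'"
    and adj: "adj b a" "adj z a'"
    and compl: "\<And>c d. c \<in> A \<Longrightarrow> d \<in> B \<Longrightarrow> d \<noteq> b \<Longrightarrow> adj c d"
  shows has_ham_path
proof -
  have fin: "finite A" "finite B"
    using finite_V V by auto
  have card: "card A = Suc (card (B - {b}))"
    using V b fin by (simp add: card_gt_0_iff)
  then have "B - {b} \<noteq> {}"
    using V(5) by (metis One_nat_def card.empty numeral_le_one_iff semiring_norm(70))
  then obtain p where "p \<noteq> []" "distinct p" "set p = A \<union> (B - {b})" "successively adj p"
    "hd p = a" "last p = a'"
    using alternating_path_same_side[of A "B - {b}" a a'] fin V in_A card compl by blast
  then show ?thesis
    using V b adj adj_sym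
    by (intro has_ham_pathI[of "b # p @ [z]"]) (auto simp: successively_Cons successively_append_iff)
qed

text \<open>Here \<open>z\<close> links the possibly deficient vertex \<open>b\<close> to a path
  through the rest that starts in \<open>a\<close>.\<close>

lemma ham_path_bipartite_extra_middle:
  assumes V: "V = insert z (A \<union> B)" "z \<notin> A \<union> B" "A \<inter> B = {}" "card A = card B" "3 \<le> card A"
    and ab: "a \<in> A" "b \<in> B" "adj z a" "adj z b"
    and compl: "\<And>c d. c \<in> A \<Longrightarrow> d \<in> B \<Longrightarrow> d \<noteq> b \<Longrightarrow> adj c d"
  shows has_ham_path
proof -
  have fin: "finite A" "finite B"
    using finite_V V by auto
  have card: "card A = Suc (card (B - {b}))"
    using V ab fin by (simp add: card_gt_0_iff)
  then have "0 < card (B - {b})" "0 < card (A - {a})"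
    using V(5) ab fin by simp_all
  then obtain a' where "a' \<in> A - {a}" "B - {b} \<noteq> {}"
    by (metis card_gt_0_iff ex_in_conv)
  then obtain p where "p \<noteq> []" "distinct p" "set p = A \<union> (B - {b})" "successively adj p" "hd p = a"
    using alternating_path_same_side[of A "B - {b}" a a'] fin V ab card compl by blast
  then show ?thesis
    using V ab adj_sym
    by (intro has_ham_pathI[of "b # z # p"]) (auto simp: successively_Cons)
qed

end

section \<open>Graphs of maximum degree two\<close>

text \<open>\<open>closed_eq_V\<close> is connectedness, in the form in which the proofs use it: a
  property that spreads along edges and holds somewhere holds everywhere.\<close>

locale conn_claw_heavy_graph = fin_simple_graph +
  assumes V_nonempty: "V \<noteq> {}"
    and closed_eq_V: "\<lbrakk>S \<noteq> {}; S \<subseteq> V; \<And>u v. u \<in> S \<Longrightarrow> adj u v \<Longrightarrow> v \<in> S\<rbrakk> \<Longrightarrow> S = V"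
    and claw_heavy: "\<lbrakk>adj v a; adj v b; adj v c; a \<noteq> b; a \<noteq> c; b \<noteq> c;
        \<not> adj a b; \<not> adj a c; \<not> adj b c\<rbrakk> \<Longrightarrow>
      card V - 1 \<le> card (nbh a) + card (nbh b) \<or> card V - 1 \<le> card (nbh a) + card (nbh c) \<or>
      card V - 1 \<le> card (nbh b) + card (nbh c)"
begin

lemma nbh_nonempty:
  assumes "v \<in> V" "card V \<noteq> 1"
  shows "\<exists>u. adj v u"
proof (rule ccontr)
  assume "\<nexists>u. adj v u"
  then have "{v} = V"
    using assms by (intro closed_eq_V) auto
  then show False
    using assms(2) by auto
qed

lemma path_leaving_edge:
  assumes "set p \<noteq> V" "path p" "p \<noteq> []"
  obtains w u where "w \<in> set p" "adj w u" "u \<notin> set p" "u \<in> V"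
proof -
  have "\<exists>w\<in>set p. \<exists>u. adj w u \<and> u \<notin> set p"
  proof (rule ccontr)
    assume "\<not> ?thesis"
    then have "set p = V"
      using assms by (intro closed_eq_V) (auto simp: path_def)
    then show False
      using assms(1) by simp
  qed
  then show ?thesis
    using that adj_V adj_sym by blast
qed

lemma longest_path_nonempty:
  assumes "\<And>q. path q \<Longrightarrow> length q \<le> length p"
  shows "p \<noteq> []"
proof -
  obtain v where "v \<in> V"
    using V_nonempty by blast
  then have "path [v]"
    by (simp add: path_def)
  then show ?thesis
    using assms[of "[v]"] by auto
qed

text \<open>A vertex \<open>w\<close> of a longest path with a neighbour \<open>u\<close> off the
  path is not an end, so \<open>u\<close> and the two path neighbours of \<open>w\<close> give it
  degree three.\<close>

lemma ham_path_if_max_degree_2: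
  assumes "\<And>v. deg v \<le> 2"
  shows has_ham_path
proof -
  obtain p where p: "path p" and longest: "\<And>q. path q \<Longrightarrow> length q \<le> length p"
    using longest_path by blast
  have ne: "p \<noteq> []"
    using longest_path_nonempty longest by blast
  have "set p = V"
  proof (rule ccontr)
    assume "set p \<noteq> V"
    then obtain w u where wu: "w \<in> set p" "adj w u" "u \<notin> set p"
      using path_leaving_edge p ne by metis
    obtain i where i: "i < length p" "w = p ! i"
      using wu(1) by (metis in_set_conv_nth)
    have "path (u # p)" if "w = hd p"
      using that p ne wu adj_sym by (simp add: path_Cons)
    then have "w \<noteq> hd p"
      using longest[of "u # p"] by auto
    have "path (u # rev p)" if "w = last p"
      using that path_rev[OF p] ne wu adj_sym by (simp add: path_Cons hd_rev)
    then have "w \<noteq> last p"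
      using longest[of "u # rev p"] by auto
    have "i \<noteq> 0" "i \<noteq> length p - 1"
      using \<open>w \<noteq> hd p\<close> \<open>w \<noteq> last p\<close> i(2) ne by (metis hd_conv_nth, metis last_conv_nth)
    then obtain j where j: "i = Suc j" and "Suc i < length p"
      using i(1) by (cases i) auto
    have succ: "adj (p ! k) (p ! Suc k)" if "Suc k < length p" for k
      using p that by (auto simp: path_def successively_conv_nth)
    have "adj w (p ! j)" "adj w (p ! Suc i)"
      using succ[of j] succ[of i] adj_sym i j \<open>Suc i < length p\<close> by auto
    moreover have "p ! j \<noteq> p ! Suc i" "p ! j \<noteq> u" "p ! Suc i \<noteq> u"
      using p wu i j \<open>Suc i < length p\<close> by (auto simp: path_def nth_eq_iff_index_eq)
    ultimately have "{u, p ! j, p ! Suc i} \<subseteq> nbh w" "card {u, p ! j, p ! Suc i} = 3"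
      using wu by auto
    then have "3 \<le> deg w"
      by (metis card_mono finite_nbh)
    then show False
      using assms[of w] by simp
  qed
  then show ?thesis
    using p by (auto simp: has_ham_path_def)
qed

end

section \<open>Graphs with a triangle\<close>

text \<open>Paw is another name for \<open>Z1\<close>: here \<open>a\<close>, \<open>b\<close>,
  \<open>c\<close> form the triangle and \<open>d\<close> hangs at \<open>a\<close>.\<close>

locale conn_claw_heavy_paw_free_graph = conn_claw_heavy_graph +
  assumes paw_free: "\<lbrakk>adj a b; adj b c; adj a c; adj a d; d \<noteq> b; d \<noteq> c\<rbrakk> \<Longrightarrow> adj b d \<or> adj c d"
begin

text \<open>The set \<open>S\<close> of vertices on triangles is closed under adjacency: if an edge
  leaves a triangle, its outer end is adjacent to a second vertex of the triangle, so the edge lies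
  on a triangle itself.\<close>

lemma edge_in_triangle:
  assumes t: "adj a b" "adj b c" "adj a c" and "adj u v"
  shows "\<exists>w. adj u w \<and> adj v w"
proof -
  define S where "S = {x. \<exists>y z. adj x y \<and> adj y z \<and> adj x z}"
  have step: "\<exists>w. adj u w \<and> adj v w" if "u \<in> S" "adj u v" for u v
  proof -
    obtain y z where "adj u y" "adj y z" "adj u z"
      using \<open>u \<in> S\<close> by (auto simp: S_def)
    then show ?thesis
      using paw_free[of u y z v] that adj_commute by metis
  qed
  have "S = V"
  proof (rule closed_eq_V)
    show "S \<noteq> {}"
      using t by (auto simp: S_def)
    show "S \<subseteq> V"
      using adj_V by (auto simp: S_def)
    show "v \<in> S" if "u \<in> S" "adj u v" for u v
      using step[OF that] that adj_commute by (auto simp: S_def)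
  qed
  then show ?thesis
    using step assms(4) adj_V by blast
qed

text \<open>By connectedness it suffices that the set \<open>X\<close> of vertices on or adjacent to
  the edge is closed under adjacency.\<close>

lemma edge_dominates:
  assumes t: "adj a b" "adj b c" "adj a c" and uw: "adj u w"
    and "v \<in> V" "v \<noteq> u" "v \<noteq> w"
  shows "adj v u \<or> adj v w"
proof -
  define X where "X = {v \<in> V. v = u \<or> v = w \<or> adj v u \<or> adj v w}"
  text \<open>A vertex \<open>y\<close> at distance two from the edge \<open>uw\<close>, reached through a neighbour \<open>v\<close> of \<open>u\<close>,
    is the pendant vertex of a \<open>Z\<^sub>1\<close>.\<close>
  have key: False
    if uw: "adj u w" and vu: "adj v u" and *: "adj v y" "y \<noteq> u" "y \<noteq> w" "\<not> adj y u" "\<not> adj y w" for u v w y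
  proof (cases "adj v w")
    case True
    then show False
      using paw_free[of v u w y] uw vu * adj_commute by metis
  next
    case False
    \<comment> \<open>The triangle \<open>u v s\<close> with \<open>y\<close> at \<open>v\<close>
      forces \<open>s\<close> to be adjacent to \<open>y\<close>, and with \<open>w\<close> at
      \<open>u\<close> it forces \<open>s\<close> to be adjacent to \<open>w\<close>. Then
      \<open>s u w\<close> with \<open>y\<close> at \<open>s\<close> is a \<open>Z1\<close>.\<close>
    obtain s where s: "adj u s" "adj v s"
      using edge_in_triangle[OF t] vu adj_commute by metis
    have "adj s y"
      using paw_free[of v u s y] s uw vu * adj_commute by metis
    have "adj s w"
      using paw_free[of u v s w] s uw vu * False adj_commute by metis
    show False
      using paw_free[of s u w y] s \<open>adj s y\<close> \<open>adj s w\<close> uw vu * adj_commute by metis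
  qed
  have "X = V"
  proof (rule closed_eq_V)
    show "X \<noteq> {}" "X \<subseteq> V"
      using uw adj_V by (auto simp: X_def)
    fix x y assume "x \<in> X" "adj x y"
    then show "y \<in> X"
      using key[of u w x y] key[of w u x y] uw adj_V adj_commute unfolding X_def mem_Collect_eq
      by metis
  qed
  then show ?thesis
    using assms by (auto simp: X_def)
qed

lemma ham_path_if_triangle:
  assumes t: "adj a b" "adj b c" "adj a c"
  shows has_ham_path
proof -
  have dom: "adj v u \<or> adj v w" if "adj u w" "v \<in> V" "v \<noteq> u" "v \<noteq> w" for u v w
    using edge_dominates[OF t] that by blast
  \<comment> \<open>For a neighbour \<open>x\<close> of \<open>u\<close>, the edge
    \<open>u x\<close> dominates \<open>v\<close>, so \<open>v\<close> is adjacent to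
    \<open>x\<close>.\<close>
  have twins: "nbh u = nbh v" if "u \<in> V" "v \<in> V" "\<not> adj u v" for u v
    using that dom adj_commute unfolding nbh_def by blast
  have "{a, b, c} \<subseteq> V" "card {a, b, c} = 3"
    using t adj_V adj_sym adj_irrefl by (auto simp: card_insert_if)
  then have n3: "3 \<le> card V"
    by (metis card_mono finite_V)
  have half: "card V - 1 \<le> 2 * deg u" if u: "u \<in> V" for u
  proof (cases "\<exists>v w. {v, w} \<subseteq> V - nbh u - {u} \<and> v \<noteq> w")
    case True
    then obtain v w where vw: "v \<in> V" "w \<in> V" "\<not> adj u v" "\<not> adj u w" "v \<noteq> u" "w \<noteq> u" "v \<noteq> w"
      by auto
    \<comment> \<open>An edge \<open>v w\<close> would dominate \<open>u\<close>. So
      \<open>u\<close>, \<open>v\<close>, \<open>w\<close> are pairwise nonadjacent twins and form a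
      claw with any common neighbour; every degree sum of two leaves is
      \<open>2 * deg u\<close>.\<close>
    have "\<not> adj v w"
      using dom[of v w u] vw u by metis
    moreover obtain x where "adj u x"
      using nbh_nonempty[OF u] n3 by auto
    moreover have "nbh u = nbh v" "nbh u = nbh w"
      using twins[of u v] twins[of u w] vw u by blast+
    moreover from this have "adj v x" "adj w x"
      using \<open>adj u x\<close> by (metis in_nbh)+
    ultimately show ?thesis
      using claw_heavy[of x u v w] vw adj_commute by (metis mult_2)
  next
    case False
    \<comment> \<open>With at most one nonneighbour, \<open>deg u\<close> is at least
      \<open>card V - 2\<close>, which suffices since \<open>card V\<close> is at least 3.\<close>
    have "card (V - nbh u - {u}) \<le> 1"
    proof (rule ccontr)
      assume "\<not> ?thesis"
      then have "2 \<le> card (V - nbh u - {u})"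
        by simp
      then obtain T where "T \<subseteq> V - nbh u - {u}" "card T = 2"
        using obtain_subset_with_card_n by metis
      moreover then obtain x y where "T = {x, y}" "x \<noteq> y"
        by (meson card_2_iff)
      ultimately show False
        using False by blast
    qed
    moreover have "card (V - nbh u - {u}) = card V - deg u - 1"
      using that finite_V nbh_subset[of u] adj_irrefl by (simp add: card_Diff_subset)
    ultimately show ?thesis
      using n3 by linarith
  qed
  obtain p where p: "path p" and longest: "\<And>q. path q \<Longrightarrow> length q \<le> length p"
    using longest_path by blast
  have ne: "p \<noteq> []"
    using longest_path_nonempty longest by blast
  have "set p = V"
  proof (rule ccontr)
    assume "set p \<noteq> V"
    then obtain u where u: "u \<in> V" "u \<notin> set p"
      using path_leaving_edge p ne by metis
    have end1: "\<not> adj y (hd p)" if "y \<notin> set p" for y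
      using longest[of "y # p"] that p ne by (auto simp: path_Cons)
    have end2: "\<not> adj u (last p)"
      using longest[of "u # rev p"] u path_rev[OF p] ne by (auto simp: path_Cons hd_rev)
    have "hd p \<in> V"
      using p ne hd_in_set unfolding path_def by blast
    \<comment> \<open>All neighbours of \<open>hd p\<close> lie on the longest path
      \<open>p\<close>; its twin \<open>u\<close> therefore has all its neighbours on
      \<open>p\<close> too.\<close>
    then have "nbh u = nbh (hd p)"
      using twins[of u "hd p"] end1[of u] u by blast
    then have nbh_p: "y \<in> set p" if "adj u y" for y
      using end1[of y] that adj_commute in_nbh by metis
    define I where "I = {i. i < length p \<and> adj u (p ! i)}"
    have "nbh u = (!) p ` I"
      using nbh_p by (force simp: I_def in_set_conv_nth image_iff)
    then have "deg u \<le> card I"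
      by (simp add: card_image_le I_def)
    have "Suc i < length p" if "i \<in> I" for i
    proof -
      have "i < length p" "adj u (p ! i)"
        using that by (auto simp: I_def)
      moreover from this have "i \<noteq> length p - 1"
        using end2 ne by (metis last_conv_nth)
      ultimately show ?thesis
        by linarith
    qed
    moreover from this have "Suc i \<notin> I" if "i \<in> I" for i
      using path_insert[OF p, of i u] longest that u by (fastforce simp: I_def)
    moreover have "0 \<notin> I"
      using end1 u ne by (auto simp: I_def hd_conv_nth)
    \<comment> \<open>Positions in \<open>I\<close> and their successors are distinct and avoid
      position 0, so \<open>2 * deg u\<close> is at most \<open>length p - 1\<close>, hence at most
      \<open>card V - 2\<close>.\<close>
    ultimately have "I \<inter> Suc ` I = {}" "I \<union> Suc ` I \<subseteq> {1..<length p}"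
      by (auto simp: I_def intro: Suc_leI) (metis One_nat_def Suc_leI gr0I)+
    then have "card I + card (Suc ` I) \<le> card {1..<length p}"
      by (metis card_Un_disjoint card_mono finite_Un finite_atLeastLessThan finite_subset)
    moreover have "length p < card V"
      using p u finite_V distinct_card by (metis path_def psubsetI psubset_card_mono)
    ultimately have "2 * deg u < card V - 1"
      using \<open>deg u \<le> card I\<close> ne by (cases p) (auto simp: card_image)
    then show False
      using half[OF u(1)] by simp
  qed
  then show ?thesis
    using p by (auto simp: has_ham_path_def)
qed

end

section \<open>Triangle-free graphs\<close>

locale conn_claw_heavy_triangle_free_graph = conn_claw_heavy_graph +
  assumes triangle_free: "adj a b \<Longrightarrow> adj b c \<Longrightarrow> \<not> adj a c"
begin

lemma nbh_indep: "a \<in> nbh v \<Longrightarrow> b \<in> nbh v \<Longrightarrow> \<not> adj a b"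
  using triangle_free[of v a b] by auto

text \<open>\<open>a\<^sub>1\<close> and \<open>a\<^sub>2\<close> are two neighbours of least
  degree. In their claw with a further neighbour \<open>a\<close>, no pair of leaves has a larger
  degree sum than \<open>a\<^sub>2\<close> and \<open>a\<close>. The vertex \<open>a\<^sub>3\<close>
  witnesses that such an \<open>a\<close> exists.\<close>

lemma heavy_nbh:
  assumes "3 \<le> deg v"
  obtains a\<^sub>1 a\<^sub>2 a\<^sub>3 where "adj v a\<^sub>1" "adj v a\<^sub>2" "adj v a\<^sub>3" "a\<^sub>1 \<noteq> a\<^sub>2" "a\<^sub>1 \<noteq> a\<^sub>3" "a\<^sub>2 \<noteq> a\<^sub>3"
    "\<And>a. adj v a \<Longrightarrow> a \<noteq> a\<^sub>1 \<Longrightarrow> a \<noteq> a\<^sub>2 \<Longrightarrow> deg a\<^sub>2 \<le> deg a \<and> card V - 1 \<le> deg a\<^sub>2 + deg a"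
proof -
  have min: "\<exists>a\<in>T. \<forall>b\<in>T. deg a \<le> deg b" if "finite T" "T \<noteq> {}" for T
    using ex_is_arg_min_if_finite[OF that, of deg] by (auto simp: is_arg_min_def not_less)
  have "nbh v \<noteq> {}"
    using assms by auto
  then obtain a\<^sub>1 where a1: "a\<^sub>1 \<in> nbh v" "\<forall>b\<in>nbh v. deg a\<^sub>1 \<le> deg b"
    using min[of "nbh v"] by auto
  have c2: "2 \<le> card (nbh v - {a\<^sub>1})"
    using a1 assms by simp
  then have "nbh v - {a\<^sub>1} \<noteq> {}"
    by (metis card.empty not_numeral_le_zero)
  then have "\<exists>a\<in>nbh v - {a\<^sub>1}. \<forall>b\<in>nbh v - {a\<^sub>1}. deg a \<le> deg b"
    by (intro min) simp
  then obtain a\<^sub>2 where a2: "a\<^sub>2 \<in> nbh v - {a\<^sub>1}" "\<forall>b\<in>nbh v - {a\<^sub>1}. deg a\<^sub>2 \<le> deg b"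
    by blast
  have "1 \<le> card (nbh v - {a\<^sub>1} - {a\<^sub>2})"
    using a2(1) c2 by simp
  then obtain a\<^sub>3 where a3: "a\<^sub>3 \<in> nbh v - {a\<^sub>1} - {a\<^sub>2}"
    by (metis One_nat_def card.empty ex_in_conv not_less_eq_eq zero_le)
  have "deg a\<^sub>2 \<le> deg a \<and> card V - 1 \<le> deg a\<^sub>2 + deg a" if a: "adj v a" "a \<noteq> a\<^sub>1" "a \<noteq> a\<^sub>2" for a
  proof -
    have "deg a\<^sub>1 \<le> deg a\<^sub>2" "deg a\<^sub>2 \<le> deg a"
      using a1 a2 a by auto
    then show ?thesis
      using claw_heavy[of v a\<^sub>1 a\<^sub>2 a] a1(1) a2(1) a nbh_indep[of _ v] by force
  qed
  then show ?thesis
    using a1(1) a2(1) a3 by (intro that[of a\<^sub>1 a\<^sub>2 a\<^sub>3]) auto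
qed

text \<open>With \<open>2m + 1\<close> vertices and maximum degree \<open>m\<close>, a pair of vertices has degree sum \<open>\<ge> 2m\<close> only if
  both have degree \<open>m\<close>.\<close>

lemma few_light_nbrs:
  assumes "card V = Suc (2 * m)" "\<And>v. deg v \<le> m" "3 \<le> deg v"
  obtains a where "adj v a" "\<And>b. adj v b \<Longrightarrow> b \<noteq> a \<Longrightarrow> deg b = m"
proof -
  obtain a\<^sub>1 a\<^sub>2 a\<^sub>3 where "adj v a\<^sub>1" "adj v a\<^sub>2" "adj v a\<^sub>3" "a\<^sub>1 \<noteq> a\<^sub>2" "a\<^sub>1 \<noteq> a\<^sub>3" "a\<^sub>2 \<noteq> a\<^sub>3"
    and *: "\<And>a. adj v a \<Longrightarrow> a \<noteq> a\<^sub>1 \<Longrightarrow> a \<noteq> a\<^sub>2 \<Longrightarrow> deg a\<^sub>2 \<le> deg a \<and> card V - 1 \<le> deg a\<^sub>2 + deg a"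
    using heavy_nbh[OF assms(3)] by metis
  have "2 * m \<le> deg a\<^sub>2 + deg b" if "adj v b" "b \<noteq> a\<^sub>1" "b \<noteq> a\<^sub>2" for b
    using *[OF that] assms(1) by simp
  then have big: "deg a\<^sub>2 = m \<and> deg b = m" if "adj v b" "b \<noteq> a\<^sub>1" "b \<noteq> a\<^sub>2" for b
    using assms(2)[of a\<^sub>2] assms(2)[of b] that by fastforce
  \<comment> \<open>The case \<open>b = a\<^sub>2\<close> is settled by applying \<open>big\<close>
    to \<open>a\<^sub>3\<close>.\<close>
  have "deg b = m" if "adj v b" "b \<noteq> a\<^sub>1" for b
    using big[of b] big[of a\<^sub>3] that \<open>adj v a\<^sub>3\<close> \<open>a\<^sub>1 \<noteq> a\<^sub>3\<close> \<open>a\<^sub>2 \<noteq> a\<^sub>3\<close> by metis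
  then show ?thesis
    using that \<open>adj v a\<^sub>1\<close> by blast
qed

section \<open>One vertex outside two independent sides of equal size\<close>

text \<open>Vertices of \<open>B\<close> other than \<open>b\<^sub>0\<close> have \<open>m\<close>
  neighbours, all in \<open>A\<close>, hence are joined to all of \<open>A\<close>. A path can end
  in \<open>b\<^sub>0\<close> and \<open>z\<close> unless their chosen neighbours \<open>a\<close>
  and \<open>a'\<close> coincide; then \<open>a\<close> is adjacent to \<open>z\<close> and all of
  \<open>B\<close>, exceeding degree \<open>m\<close>.\<close>

lemma ham_path_extra_not_adjacent:
  assumes V: "V = insert z (A \<union> B)" "z \<notin> A \<union> B" "A \<inter> B = {}" "card A = m" "card B = m" "3 \<le> m"
    and deg: "\<And>v. deg v \<le> m"
    and indep: "\<And>b b'. b \<in> B \<Longrightarrow> b' \<in> B \<Longrightarrow> \<not> adj b b'"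
    and light: "b\<^sub>0 \<in> B" "\<And>b. b \<in> B \<Longrightarrow> b \<noteq> b\<^sub>0 \<Longrightarrow> deg b = m"
    and not_adj: "\<And>b. b \<in> B \<Longrightarrow> \<not> adj z b"
  shows has_ham_path
proof -
  have fin: "finite A" "finite B"
    using finite_V V by auto
  have nbh_B: "nbh b \<subseteq> A" if "b \<in> B" for b
    using nbh_subset[of b] indep[OF that] not_adj[OF that] V(1) adj_commute by auto
  have compl: "adj c d" if "c \<in> A" "d \<in> B" "d \<noteq> b\<^sub>0" for c d
    using card_subset_eq[OF fin(1) nbh_B[OF that(2)]] light(2)[OF that(2,3)] V(4) that(1) adj_sym
    by (metis in_nbh)
  have "card A \<le> card V"
    by (rule card_mono[OF finite_V]) (use V(1) in auto)
  then have "card V \<noteq> 1"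
    using V(4,6) by linarith
  moreover have "b\<^sub>0 \<in> V" "z \<in> V"
    using V(1) light(1) by auto
  ultimately obtain a a' where a: "adj b\<^sub>0 a" "adj z a'"
    using nbh_nonempty by metis
  have "a' \<in> V" "a' \<noteq> z" "a' \<notin> B"
    using a(2) adj_V adj_sym adj_irrefl not_adj by blast+
  then have in_A: "a \<in> A" "a' \<in> A"
    using a(1) nbh_B[OF light(1)] V(1) by auto
  show ?thesis
  proof (cases "a = a'")
    case True
    then have "adj a z"
      using a(2) adj_sym by blast
    moreover have "adj a b" if "b \<in> B" for b
      using compl[OF in_A(1) that] a(1) adj_sym by (cases "b = b\<^sub>0") auto
    ultimately have "insert z B \<subseteq> nbh a"
      by auto
    then have "card (insert z B) \<le> deg a"
      by (rule card_mono[OF finite_nbh])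
    then show ?thesis
      using deg[of a] V fin by simp
  next
    case False
    show ?thesis
      by (rule ham_path_bipartite_extra_end[of z A B b\<^sub>0 a a']) (use False V light(1) in_A a compl in auto)
  qed
qed

text \<open>Without a Hamiltonian path, each side has a vertex of degree other than \<open>m\<close>
  besides \<open>a\<close> and \<open>b\<close>, so \<open>a\<close> and \<open>b\<close> have
  degree \<open>m\<close>. Then \<open>a\<close> is adjacent to both \<open>z\<close> and
  \<open>b\<^sub>0\<close>, two neighbours of degree other than \<open>m\<close>, against
  \<open>few_light_nbrs\<close>.\<close>

lemma ham_path_extra_one_nbr:
  assumes V: "V = insert z (A \<union> B)" "z \<notin> A \<union> B" "A \<inter> B = {}" "card A = m" "card B = m" "3 \<le> m"
    and deg: "\<And>v. deg v \<le> m"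
    and indep_A: "\<And>a a'. a \<in> A \<Longrightarrow> a' \<in> A \<Longrightarrow> \<not> adj a a'"
    and indep_B: "\<And>b b'. b \<in> B \<Longrightarrow> b' \<in> B \<Longrightarrow> \<not> adj b b'"
    and light_A: "\<And>a. a \<in> A \<Longrightarrow> a \<noteq> a\<^sub>0 \<Longrightarrow> deg a = m"
    and light_B: "\<And>b. b \<in> B \<Longrightarrow> b \<noteq> b\<^sub>0 \<Longrightarrow> deg b = m"
    and ab: "a \<in> A" "b \<in> B" "adj z a" "adj z b"
    and only_b: "\<And>b'. b' \<in> B \<Longrightarrow> adj z b' \<Longrightarrow> b' = b"
  shows has_ham_path
proof (rule ccontr)
  assume no: "\<not> has_ham_path"
  have fin: "finite A" "finite B"
    using finite_V V by auto
  have nbh_A: "nbh c \<subseteq> insert z B" if "c \<in> A" for c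
    using nbh_subset[of c] indep_A[OF that] V(1) by auto
  have nbh_B: "nbh d \<subseteq> insert z A" if "d \<in> B" for d
    using nbh_subset[of d] indep_B[OF that] V(1) by auto
  have not_adj: "\<not> adj c d" if "adj z c" "adj z d" for c d
    using triangle_free[of z c d] that by auto
  \<comment> \<open>Otherwise all of \<open>B\<close> except \<open>b\<close> is joined to all of
    \<open>A\<close>, and a Hamiltonian path can start with \<open>b\<close>, \<open>z\<close>,
    \<open>a\<close>.\<close>
  have "\<exists>d\<in>B. d \<noteq> b \<and> deg d \<noteq> m"
  proof (rule ccontr)
    assume *: "\<not> ?thesis"
    have "adj c d" if "c \<in> A" "d \<in> B" "d \<noteq> b" for c d
    proof -
      have "nbh d \<subseteq> A"
        using nbh_B[OF that(2)] only_b[OF that(2)] that(3) adj_commute by auto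
      then show ?thesis
        using card_subset_eq[OF fin(1)] * that V(4) adj_sym by (metis in_nbh)
    qed
    then show False
      using ham_path_bipartite_extra_middle[of z A B a b] V ab no by auto
  qed
  then have b0: "b\<^sub>0 \<in> B" "b\<^sub>0 \<noteq> b" "deg b\<^sub>0 \<noteq> m"
    using light_B by auto
  then have "deg b = m"
    using light_B ab by auto
  \<comment> \<open>By triangle-freeness \<open>b\<close> misses the other neighbours of
    \<open>z\<close>; two of them in \<open>A\<close> would leave \<open>b\<close> at most
    \<open>m - 1\<close> neighbours, \<open>z\<close> included.\<close>
  have only_a: "c = a" if "c \<in> A" "adj z c" for c
  proof (rule ccontr)
    assume "c \<noteq> a"
    have "nbh b \<subseteq> insert z (A - {a, c})"
      using nbh_B[OF ab(2)] not_adj[OF ab(4)] ab(3) that(2) by auto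
    then have "deg b \<le> card (insert z (A - {a, c}))"
      using fin by (intro card_mono) auto
    also have "\<dots> = Suc (m - 2)"
      using V fin ab that \<open>c \<noteq> a\<close> by (simp add: card_Diff_subset)
    finally show False
      using \<open>deg b = m\<close> V by simp
  qed
  have "nbh z \<subseteq> {a, b}"
    using nbh_subset[of z] V(1) only_a only_b adj_irrefl by auto
  then have "deg z \<le> card {a, b}"
    by (intro card_mono) auto
  also have "\<dots> \<le> 2"
    by (simp add: card_insert_if)
  finally have "deg z \<noteq> m"
    using V by simp
  have "\<exists>c\<in>A. c \<noteq> a \<and> deg c \<noteq> m"
  proof (rule ccontr)
    assume *: "\<not> ?thesis"
    have compl: "adj d c" if "c \<in> A" "d \<in> B" "c \<noteq> a" for c d
    proof -
      have "nbh c \<subseteq> B"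
        using nbh_A[OF that(1)] only_a[OF that(1)] that(3) adj_commute by auto
      then show ?thesis
        using card_subset_eq[OF fin(2)] * that V(5) adj_sym by (metis in_nbh)
    qed
    have has_ham_path
      by (rule ham_path_bipartite_extra_middle[of z B A b a]) (use V ab compl in auto)
    then show False
      using no by simp
  qed
  then have "deg a = m"
    using light_A ab by metis
  moreover have "nbh a \<subseteq> insert z (B - {b})"
    using nbh_A[OF ab(1)] not_adj[OF ab(3)] ab(4) by auto
  moreover have "card (insert z (B - {b})) = m"
    using V fin ab by simp
  ultimately have "nbh a = insert z (B - {b})"
    using fin by (intro card_subset_eq) auto
  then have "adj a z" "adj a b\<^sub>0" "z \<noteq> b\<^sub>0"
    using b0 V by auto
  moreover have "card V = Suc (2 * m)"
    using V fin by (simp add: card_Un_disjoint)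
  ultimately show False
    using few_light_nbrs[of m a] deg \<open>deg a = m\<close> V(6) \<open>deg z \<noteq> m\<close> b0(3) by metis
qed

lemma ham_path_extra:
  assumes V: "V = insert z (A \<union> B)" "z \<notin> A \<union> B" "A \<inter> B = {}" "card A = m" "card B = m" "3 \<le> m"
    and deg: "\<And>v. deg v \<le> m"
    and indep_A: "\<And>a a'. a \<in> A \<Longrightarrow> a' \<in> A \<Longrightarrow> \<not> adj a a'"
    and indep_B: "\<And>b b'. b \<in> B \<Longrightarrow> b' \<in> B \<Longrightarrow> \<not> adj b b'"
    and light_A: "a\<^sub>0 \<in> A" "\<And>a. a \<in> A \<Longrightarrow> a \<noteq> a\<^sub>0 \<Longrightarrow> deg a = m"
    and light_B: "b\<^sub>0 \<in> B" "\<And>b. b \<in> B \<Longrightarrow> b \<noteq> b\<^sub>0 \<Longrightarrow> deg b = m"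
  shows has_ham_path
proof -
  have V': "V = insert z (B \<union> A)" "z \<notin> B \<union> A" "B \<inter> A = {}"
    using V by auto
  have fin: "finite A" "finite B"
    using finite_V V by auto
  \<comment> \<open>One of \<open>a\<close>, \<open>a'\<close> differs from \<open>a\<^sub>0\<close>
    and has degree \<open>m\<close>, but it misses both \<open>b\<close> and \<open>b'\<close> if
    these are distinct. So \<open>z\<close> has at most one neighbour on some side.\<close>
  have unique: "b = b'"
    if *: "a \<in> A" "a' \<in> A" "a \<noteq> a'" "adj z a" "adj z a'" "b \<in> B" "b' \<in> B" "adj z b" "adj z b'"
    for a a' b b'
  proof (rule ccontr)
    assume "b \<noteq> b'"
    obtain c where c: "c \<in> A" "adj z c" "deg c = m"
      using * light_A(2) by metis
    have "nbh c \<subseteq> insert z (B - {b, b'})"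
      using nbh_subset[of c] indep_A[OF c(1)] V(1) triangle_free[OF c(2)] * by auto
    then have "deg c \<le> card (insert z (B - {b, b'}))"
      using fin by (intro card_mono) auto
    also have "\<dots> = Suc (m - 2)"
      using V fin that \<open>b \<noteq> b'\<close> by (simp add: card_Diff_subset)
    finally show False
      using c(3) V(6) by simp
  qed
  consider "\<And>b. b \<in> B \<Longrightarrow> \<not> adj z b" | "\<And>a. a \<in> A \<Longrightarrow> \<not> adj z a"
    | a b where "a \<in> A" "b \<in> B" "adj z a" "adj z b"
    by blast
  then show ?thesis
  proof cases
    case 1
    then show ?thesis
      using ham_path_extra_not_adjacent[OF V deg indep_B light_B] by blast
  next
    case 2
    then show ?thesis
      using ham_path_extra_not_adjacent[OF V' V(5,4,6) deg indep_A light_A] by blast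
  next
    case 3
    show ?thesis
    proof (cases "\<exists>a'\<in>A. a' \<noteq> a \<and> adj z a'")
      case True
      then have "b' = b" if "b' \<in> B" "adj z b'" for b'
        using unique[of a _ b b'] 3 that by metis
      then show ?thesis
        using ham_path_extra_one_nbr[OF V deg indep_A indep_B light_A(2) light_B(2) 3] by blast
    next
      case False
      then show ?thesis
        using ham_path_extra_one_nbr[OF V' V(5,4,6) deg indep_B indep_A light_B(2) light_A(2) 3(2,1,4,3)]
        by blast
    qed
  qed
qed

section \<open>The neighbourhoods of two adjacent vertices of large degree\<close>

lemma ham_path_if_degree_3:
  assumes "3 \<le> deg v"
  shows has_ham_path
proof -
  \<comment> \<open>Degrees vanish outside \<open>V\<close>, so the maximum over \<open>V\<close>
    bounds every degree.\<close>
  have deg_0: "deg u = 0" if "u \<notin> V" for u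
    using that adj_V by auto
  obtain x where x: "\<And>u. deg u \<le> deg x"
  proof -
    have "Max (deg ` V) \<in> deg ` V"
      using finite_V V_nonempty by simp
    then obtain x where "deg x = Max (deg ` V)"
      by force
    then have "deg u \<le> deg x" for u
      using finite_V deg_0[of u] by (cases "u \<in> V") auto
    then show ?thesis
      using that by blast
  qed
  have x3: "3 \<le> deg x"
    using assms x[of v] by simp
  obtain a\<^sub>1 a\<^sub>2 w where a: "adj x a\<^sub>1" "adj x a\<^sub>2" "adj x w" "a\<^sub>1 \<noteq> a\<^sub>2" "a\<^sub>1 \<noteq> w" "a\<^sub>2 \<noteq> w"
    and heavy: "\<And>a. adj x a \<Longrightarrow> a \<noteq> a\<^sub>1 \<Longrightarrow> a \<noteq> a\<^sub>2 \<Longrightarrow> deg a\<^sub>2 \<le> deg a \<and> card V - 1 \<le> deg a\<^sub>2 + deg a"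
    using heavy_nbh[OF x3] by metis
  define A B where "A = nbh x" and "B = nbh w"
  \<comment> \<open>\<open>w\<close> is a neighbour beyond \<open>a\<^sub>1\<close> and
    \<open>a\<^sub>2\<close>, so its degree is at least that of \<open>a\<^sub>2\<close>. As
    \<open>deg w \<le> deg x\<close>, the sum \<open>deg x + deg w\<close> is at least
    \<open>card V - 1\<close>.\<close>
  have w: "card V - 1 \<le> 2 * deg w"
    using heavy[of w] a by auto
  have disj: "A \<inter> B = {}"
    using triangle_free[OF a(3)] by (auto simp: A_def B_def)
  have sub: "A \<union> B \<subseteq> V"
    using nbh_subset by (auto simp: A_def B_def)
  have fin: "finite A" "finite B"
    by (simp_all add: A_def B_def)
  have card_AB: "card (A \<union> B) = deg x + deg w"
    using disj fin by (simp add: card_Un_disjoint A_def B_def)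
  then have le: "deg x + deg w \<le> card V"
    using sub card_mono[OF finite_V] by metis
  have indep_A: "\<not> adj u v" if "u \<in> A" "v \<in> A" for u v
    using that nbh_indep unfolding A_def by blast
  have indep_B: "\<not> adj u v" if "u \<in> B" "v \<in> B" for u v
    using that nbh_indep unfolding B_def by blast
  have mem: "a\<^sub>1 \<in> A" "a\<^sub>2 \<in> A" "w \<in> A" "x \<in> B"
    using a adj_sym[OF a(3)] by (auto simp: A_def B_def)
  show ?thesis
  proof (cases "deg x + deg w = card V")
    case True
    then have V: "V = A \<union> B"
      using card_subset_eq[OF finite_V sub] card_AB by simp
    have nbh_A: "nbh c \<subseteq> B" if "c \<in> A" for c
      using nbh_subset[of c] indep_A[OF that] V by auto
    have deg_A: "deg c \<le> deg w" if "c \<in> A" for c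
      using card_mono[OF fin(2) nbh_A[OF that]] by (simp add: B_def)
    have full: "adj c d" if "c \<in> A" "deg c = deg w" "d \<in> B" for c d
      using card_subset_eq[OF fin(2) nbh_A[OF that(1)]] that by (metis B_def in_nbh)
    have "deg x = deg w \<or> deg x = Suc (deg w)"
      using True w x[of w] by linarith
    then show ?thesis
    proof
      assume eq: "deg x = Suc (deg w)"
      \<comment> \<open>Here \<open>card V - 1 = 2 * deg w\<close>, so both summands attain the
        bound \<open>deg_A\<close>; only \<open>a\<^sub>1\<close> can be deficient.\<close>
      have big: "deg a\<^sub>2 = deg w \<and> deg c = deg w" if "c \<in> A" "c \<noteq> a\<^sub>1" "c \<noteq> a\<^sub>2" for c
        using heavy[of c] deg_A[OF that(1)] deg_A[OF mem(2)] that True eq by (auto simp: A_def)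
      have "deg c = deg w" if "c \<in> A" "c \<noteq> a\<^sub>1" for c
        using big[of c] big[of w] a mem that by metis
      then have "adj c d" if "c \<in> A" "c \<noteq> a\<^sub>1" "d \<in> B" for c d
        using full that by blast
      moreover have "card A = Suc (card B)"
        using eq by (simp add: A_def B_def)
      ultimately show ?thesis
        using ham_path_bipartite_Suc[OF V disj _ mem(1) mem(4)] a(1) adj_sym by blast
    next
      assume eq: "deg x = deg w"
      \<comment> \<open>Now \<open>card V - 1 = 2 * deg w - 1\<close>: the sum may fall one short,
        and since \<open>deg a\<^sub>2 \<le> deg c\<close>, only at
        \<open>a\<^sub>2\<close>.\<close>
      have "deg c = deg w" if "c \<in> A" "c \<noteq> a\<^sub>1" "c \<noteq> a\<^sub>2" for c
        using heavy[of c] deg_A[OF that(1)] that True eq by (auto simp: A_def)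
      then have compl: "adj c d" if "c \<in> A" "c \<noteq> a\<^sub>1" "c \<noteq> a\<^sub>2" "d \<in> B" for c d
        using full that by blast
      \<comment> \<open>\<open>a\<^sub>2\<close> falls at most one short of \<open>deg w\<close>,
        which is at least 3. A second neighbour \<open>b\<close> lets the path start with
        \<open>a\<^sub>1\<close>, \<open>x\<close>, \<open>a\<^sub>2\<close>,
        \<open>b\<close>.\<close>
      have "2 \<le> deg a\<^sub>2"
        using w heavy[OF a(3)] a(5,6) True eq x3 by auto
      then have "\<not> nbh a\<^sub>2 \<subseteq> {x}"
        using card_mono[of "{x}" "nbh a\<^sub>2"] by auto
      then obtain b where b: "b \<in> nbh a\<^sub>2" "b \<noteq> x"
        by blast
      then have "b \<in> B"
        using nbh_A[OF mem(2)] by auto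
      moreover have "card A = card B" "3 \<le> card A"
        using eq x3 by (simp_all add: A_def B_def)
      moreover have "adj a\<^sub>1 x" "adj a\<^sub>2 x"
        using a adj_sym by blast+
      ultimately show ?thesis
        using b a(4) mem compl by (intro ham_path_balanced_bipartite[OF V disj, of a\<^sub>1 a\<^sub>2 x b]) auto
    qed
  next
    case False
    define m where "m = deg x"
    \<comment> \<open>\<open>deg x + deg w = card V - 1 \<le> 2 * deg w\<close> and
      \<open>deg w \<le> deg x\<close> force equality, leaving one vertex \<open>z\<close> outside
      both neighbourhoods.\<close>
    have eq: "deg w = m" "card V = Suc (2 * m)"
      using False w x[of w] le by (auto simp: m_def)
    have cards: "card A = m" "card B = m"
      using eq by (auto simp: A_def B_def m_def)
    have "card (V - (A \<union> B)) = 1"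
      using card_Diff_subset[OF finite_subset[OF sub finite_V] sub] card_AB eq by (simp add: m_def)
    then obtain z where z: "V - (A \<union> B) = {z}"
      by (auto simp: card_1_singleton_iff)
    have deg: "deg u \<le> m" for u
      using x by (simp add: m_def)
    obtain a\<^sub>0 where "a\<^sub>0 \<in> A" "\<And>b. b \<in> A \<Longrightarrow> b \<noteq> a\<^sub>0 \<Longrightarrow> deg b = m"
      using few_light_nbrs[OF eq(2) deg x3] by (auto simp: A_def)
    moreover obtain b\<^sub>0 where "b\<^sub>0 \<in> B" "\<And>b. b \<in> B \<Longrightarrow> b \<noteq> b\<^sub>0 \<Longrightarrow> deg b = m"
      using few_light_nbrs[OF eq(2) deg, of w] x3 eq by (auto simp: B_def m_def)
    moreover have "V = insert z (A \<union> B)" "z \<notin> A \<union> B" "3 \<le> m"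
      using z sub x3 by (auto simp: m_def)
    ultimately show ?thesis
      using ham_path_extra[of z A B m a\<^sub>0 b\<^sub>0] disj cards deg indep_A indep_B by blast
  qed
qed

end

section \<open>Induced subgraphs of symmetric digraphs\<close>

lemma arcs_ends_induce_subgraph:
  "arcs_ends (G \<restriction> S) = {(u, v). u \<rightarrow>\<^bsub>G\<^esub> v \<and> u \<in> S \<and> v \<in> S}"
  by (auto simp: arcs_ends_conv image_iff)

lemma vwalk_arcs_subset_iff_successively:
  "set (vwalk_arcs p) \<subseteq> R \<longleftrightarrow> successively (\<lambda>u v. (u, v) \<in> R) p"
  by (induction p rule: vwalk_arcs.induct) auto

context graph
begin

lemma fin_simple_graph_dominates: "fin_simple_graph (verts G) (\<lambda>u v. u \<rightarrow> v)"
  using graph_symmetric adj_not_same adj_in_verts by unfold_locales auto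

lemma out_degree_eq_card: "out_degree G v = card {u. v \<rightarrow> u}"
proof -
  have "inj_on (head G) (out_arcs G v)"
    using no_multi_arcs by (auto simp: inj_on_def arc_to_ends_def)
  moreover have "head G ` out_arcs G v = {u. v \<rightarrow> u}"
    by (auto simp: arcs_ends_conv)
  ultimately show ?thesis
    by (metis card_image out_degree_def)
qed

lemma graph_induce_subgraph:
  assumes "S \<subseteq> verts G"
  shows "graph (G \<restriction> S)"
proof -
  have ind: "induced_subgraph (G \<restriction> S) G"
    using assms by (rule induced_induce)
  interpret H: digraph "G \<restriction> S"
    using ind by (rule digraphI_induced)
  show ?thesis
    using induced_graph_imp_symmetric[OF sym_arcs ind] by (rule H.graphI)
qed

lemma claw_induce_subgraph:
  assumes "v \<rightarrow> a" "v \<rightarrow> b" "v \<rightarrow> c" "a \<noteq> b" "a \<noteq> c" "b \<noteq> c"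
    and "\<not> a \<rightarrow> b" "\<not> a \<rightarrow> c" "\<not> b \<rightarrow> c"
  shows "K\<^bsub>1,3\<^esub> (G \<restriction> {v, a, b, c})"
proof -
  have sym: "a \<rightarrow> v" "b \<rightarrow> v" "c \<rightarrow> v" "\<not> b \<rightarrow> a" "\<not> c \<rightarrow> a" "\<not> c \<rightarrow> b"
    using assms graph_symmetric by blast+
  have irrefl: "\<not> u \<rightarrow> u" for u
    using adj_not_same by blast
  have neq: "v \<noteq> a" "v \<noteq> b" "v \<noteq> c"
    using assms irrefl by auto
  have "graph (G \<restriction> {v, a, b, c})"
    using assms adj_in_verts by (intro graph_induce_subgraph) auto
  moreover have "arcs_ends (G \<restriction> {v, a, b, c}) = {v} \<times> {a, b, c} \<union> {a, b, c} \<times> {v}"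
    unfolding arcs_ends_induce_subgraph using assms sym irrefl by auto
  moreover have "verts (G \<restriction> {v, a, b, c}) = {v} \<union> {a, b, c}" "{v} \<inter> {a, b, c} = {}"
    "card {v} = 1" "card {a, b, c} = 3"
    using assms neq by auto
  ultimately show ?thesis
    unfolding complete_bipartite_digraph_def by blast
qed

lemma paw_induce_subgraph:
  assumes "a \<rightarrow> b" "b \<rightarrow> c" "a \<rightarrow> c" "a \<rightarrow> d" "\<not> b \<rightarrow> d" "\<not> c \<rightarrow> d" "d \<noteq> b" "d \<noteq> c"
  shows "digraph_iso (G \<restriction> {a, b, c, d}) (with_proj Z1)"
proof -
  let ?H = "G \<restriction> {a, b, c, d}"
  \<comment> \<open>The value 0 goes to the attachment vertex \<open>a\<close>, the default value 3
    to the pendant vertex \<open>d\<close>. Arcs of \<open>Z1\<close> are pairs, so \<open>h\<close>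
    sends an arc to the images of its ends; this is injective as there are no parallel arcs.\<close>
  define f :: "'a \<Rightarrow> nat" where "f x = (if x = a then 0 else if x = b then 1 else if x = c then 2 else 3)" for x
  define h where "h = \<lparr>iso_verts = f, iso_arcs = (\<lambda>e. (f (tail G e), f (head G e))),
    iso_head = snd, iso_tail = fst\<rparr>"
  have sym: "b \<rightarrow> a" "c \<rightarrow> b" "c \<rightarrow> a" "d \<rightarrow> a" "\<not> d \<rightarrow> b" "\<not> d \<rightarrow> c"
    using assms graph_symmetric by blast+
  have irrefl: "\<not> u \<rightarrow> u" for u
    using adj_not_same by blast
  have neq: "a \<noteq> b" "b \<noteq> c" "a \<noteq> c" "a \<noteq> d"
    using assms irrefl by auto
  have f: "f a = 0" "f b = 1" "f c = 2" "f d = 3"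
    using neq assms by (auto simp: f_def)
  have inj: "inj_on f {a, b, c, d}"
    by (simp add: f inj_on_def)
  have "arcs_ends ?H \<subseteq> {(a,b), (b,a), (a,c), (c,a), (b,c), (c,b), (a,d), (d,a)}"
    unfolding arcs_ends_induce_subgraph using assms(5,6) sym(5,6) irrefl by clarsimp metis
  moreover have "{(a,b), (b,a), (a,c), (c,a), (b,c), (c,b), (a,d), (d,a)} \<subseteq> arcs_ends ?H"
    unfolding arcs_ends_induce_subgraph using assms(1-4) sym(1-4) by simp
  ultimately have "arcs_ends ?H = {(a,b), (b,a), (a,c), (c,a), (b,c), (c,b), (a,d), (d,a)}"
    by (rule equalityI)
  moreover have "iso_arcs h ` arcs ?H = map_prod f f ` arcs_ends ?H"
    by (simp add: h_def arcs_ends_conv image_image)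
  ultimately have arcs: "iso_arcs h ` arcs ?H = parcs Z1"
    by (simp add: f Z1_def)
  have verts: "iso_verts h ` verts ?H = pverts Z1"
    by (simp add: h_def f Z1_def)
  have "inj_on (iso_arcs h) (arcs ?H)"
  proof (rule inj_onI)
    fix e e' assume *: "e \<in> arcs ?H" "e' \<in> arcs ?H" "iso_arcs h e = iso_arcs h e'"
    then have "tail G e = tail G e'" "head G e = head G e'"
      using inj_onD[OF inj] by (auto simp: h_def)
    then show "e = e'"
      using * no_multi_arcs by (auto simp: arc_to_ends_def)
  qed
  then have "pre_digraph.digraph_isomorphism ?H h"
    using inj wellformed_induce_subgraph by (auto simp: pre_digraph.digraph_isomorphism_def h_def)
  moreover have "with_proj Z1 = app_iso h ?H"
    using arcs verts by (simp add: app_iso_def with_proj_def) (simp add: h_def)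
  ultimately show ?thesis
    unfolding digraph_iso_def by blast
qed

lemma closed_eq_verts:
  assumes "connected G" "S \<noteq> {}" "S \<subseteq> verts G" "\<And>u v. u \<in> S \<Longrightarrow> u \<rightarrow> v \<Longrightarrow> v \<in> S"
  shows "S = verts G"
proof -
  obtain u where u: "u \<in> S"
    using assms by blast
  have "v \<in> S" if "v \<in> verts G" for v
  proof -
    \<comment> \<open>\<open>connected\<close> refers to the symmetric closure, in which
      reachability is the same as in the symmetric digraph \<open>G\<close>.\<close>
    have "u \<rightarrow>\<^sup>* v"
      using assms u that
      by (auto simp: connected_def strongly_connected_def reachable_mk_symmetric_eq[OF sym_arcs])
    then show ?thesis
      by (induction rule: reachable_induct) (use u assms(4) in auto)
  qed
  then show ?thesis
    using assms(3) by blast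
qed

end

theorem theorem7:
  fixes G :: "('a, 'b) pre_digraph"
  assumes "graph G"
    and "connected G"
    and "claw_o_minus1_heavy G"
    and "Z1_free G"
  shows "traceable G"
proof -
  interpret graph G
    by fact
  interpret S: fin_simple_graph "verts G" "\<lambda>u v. u \<rightarrow>\<^bsub>G\<^esub> v"
    by (rule fin_simple_graph_dominates)
  have deg: "degree G v = S.deg v" for v
    by (simp add: out_degree_eq_card S.nbh_def)
  interpret S: conn_claw_heavy_graph "verts G" "\<lambda>u v. u \<rightarrow>\<^bsub>G\<^esub> v"
  proof
    show "verts G \<noteq> {}"
      using \<open>connected G\<close> by (simp add: connected_def strongly_connected_def)
    show "S = verts G" if "S \<noteq> {}" "S \<subseteq> verts G" "\<And>u v. u \<in> S \<Longrightarrow> u \<rightarrow>\<^bsub>G\<^esub> v \<Longrightarrow> v \<in> S" for S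
      using closed_eq_verts[OF \<open>connected G\<close>] that by blast
    fix v a b c
    assume *: "v \<rightarrow>\<^bsub>G\<^esub> a" "v \<rightarrow>\<^bsub>G\<^esub> b" "v \<rightarrow>\<^bsub>G\<^esub> c" "a \<noteq> b" "a \<noteq> c" "b \<noteq> c"
      "\<not> a \<rightarrow>\<^bsub>G\<^esub> b" "\<not> a \<rightarrow>\<^bsub>G\<^esub> c" "\<not> b \<rightarrow>\<^bsub>G\<^esub> c"
    have "induced_subgraph (G \<restriction> {v, a, b, c}) G"
      using * adj_in_verts by (intro induced_induce) auto
    then obtain x y where xy: "x \<in> {v, a, b, c}" "y \<in> {v, a, b, c}" "x \<noteq> y" "\<not> x \<rightarrow>\<^bsub>G\<^esub> y"
      "card (verts G) - 1 \<le> S.deg x + S.deg y"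
      using \<open>claw_o_minus1_heavy G\<close> claw_induce_subgraph[OF *]
      unfolding claw_o_minus1_heavy_def deg by (metis induce_subgraph_verts)
    \<comment> \<open>The centre is adjacent to every leaf, so the nonadjacent pair consists of
      leaves.\<close>
    have "x \<noteq> v" "y \<noteq> v"
      using xy * S.adj_sym by blast+
    then show "card (verts G) - 1 \<le> S.deg a + S.deg b \<or> card (verts G) - 1 \<le> S.deg a + S.deg c \<or>
        card (verts G) - 1 \<le> S.deg b + S.deg c"
      using xy by (auto simp: add.commute)
  qed
  have "S.has_ham_path"
  proof (cases "\<exists>a b c. a \<rightarrow>\<^bsub>G\<^esub> b \<and> b \<rightarrow>\<^bsub>G\<^esub> c \<and> a \<rightarrow>\<^bsub>G\<^esub> c")
    case True
    interpret S: conn_claw_heavy_paw_free_graph "verts G" "\<lambda>u v. u \<rightarrow>\<^bsub>G\<^esub> v"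
    proof
      fix a b c d
      assume *: "a \<rightarrow>\<^bsub>G\<^esub> b" "b \<rightarrow>\<^bsub>G\<^esub> c" "a \<rightarrow>\<^bsub>G\<^esub> c" "a \<rightarrow>\<^bsub>G\<^esub> d" "d \<noteq> b" "d \<noteq> c"
      then have "induced_subgraph (G \<restriction> {a, b, c, d}) G"
        using adj_in_verts by (intro induced_induce) auto
      then show "b \<rightarrow>\<^bsub>G\<^esub> d \<or> c \<rightarrow>\<^bsub>G\<^esub> d"
        using \<open>Z1_free G\<close> paw_induce_subgraph[OF *(1-4) _ _ *(5,6)] unfolding Z1_free_def by blast
    qed
    show ?thesis
      using True S.ham_path_if_triangle by blast
  next
    case False
    interpret S: conn_claw_heavy_triangle_free_graph "verts G" "\<lambda>u v. u \<rightarrow>\<^bsub>G\<^esub> v"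
      using False by unfold_locales blast
    \<comment> \<open>Either some degree is at least three, or all are at most two.\<close>
    show ?thesis
      using S.ham_path_if_degree_3 S.ham_path_if_max_degree_2
      by (metis not_less_eq_eq numeral_2_eq_2 numeral_3_eq_3)
  qed
  then obtain p where "distinct p" "set p = verts G" "successively (\<lambda>u v. u \<rightarrow>\<^bsub>G\<^esub> v) p"
    by (auto simp: S.has_ham_path_def S.path_def)
  \<comment> \<open>A \<open>vpath\<close> must be nonempty, which holds because
    \<open>verts G\<close> is.\<close>
  then have "vpath p G"
    using S.V_nonempty unfolding vpath_def vwalk_def vwalk_arcs_subset_iff_successively
    by (metis order_refl set_empty)
  then show ?thesis
    using \<open>set p = verts G\<close> by (auto simp: traceable_def)
qed

end
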